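(* Let $(X,\Sigma_X)$ and $(Y,\Sigma_Y)$ be measurable spaces. Let $\mu$ be a probability measure on $X$ and consider a proposal kernel $Q(\mathbf{q},d\tilde{\mathbf{q}})=F(\mathbf{q},\cdot)^*\mathcal{V}(\mathbf{q},\cdot)(d\tilde{\mathbf{q}})$, where $\mathcal{V}:X\times\Sigma_Y\to[0,1]$ is a Markov kernel and $F:X\times Y\to X$ is a measurable mapping such that, for each fixed $\mathbf{q}\in X$, the map $F(\mathbf{q},\cdot):Y\to X$ is one-to-one (in the sense of invertible) and, additionally, its inverse $F(\mathbf{q},\cdot)^{-1}$ is measurable. Define probability measures on $X\times X$ by $$\eta(d\mathbf{q},d\tilde{\mathbf{q}})=\mu(d\mathbf{q})\,Q(\mathbf{q},d\tilde{\mathbf{q}}),\qquad\eta^\perp(d\mathbf{q},d\tilde{\mathbf{q}})=\eta(d\tilde{\mathbf{q}},d\mathbf{q})=\mu(d\tilde{\mathbf{q}})\,Q(\tilde{\mathbf{q}},d\mathbf{q}).$$ Let $S:X\times Y\to X\times Y$ be the unique mapping satisfying $\Pi_1\circ S=F$ and $S\circ S=I$, given by $$S(\mathbf{q},\mathbf{v})=\bigl(F(\mathbf{q},\mathbf{v}),F(F(\mathbf{q},\mathbf{v}),\cdot)^{-1}(\mathbf{q})\bigr),$$ and let $\mathcal{M}$ be the probability measure on $X\times Y$ defined by $\mathcal{M}(d\mathbf{q},d\mathbf{v})=\mathcal{V}(\mathbf{q},d\mathbf{v})\,\mu(d\mathbf{q})$. Then: (i) The measure $\eta^\perp$ is absolutely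 continuous with respect to $\eta$ if and only if $S^*\mathcal{M}$ is absolutely continuous with respect to $\mathcal{M}$. (ii) Under either of the equivalent circumstances in (i), $$\frac{d\eta^\perp}{d\eta}(\mathbf{q},F(\mathbf{q},\mathbf{v}))=\frac{dS^*\mathcal{M}}{d\mathcal{M}}(\mathbf{q},\mathbf{v})\quad\text{for }\mathcal{M}\text{-a.e. }(\mathbf{q},\mathbf{v})\in X\times Y,$$ or, equivalently, $$\frac{d\eta^\perp}{d\eta}(\mathbf{q},\tilde{\mathbf{q}})=\frac{dS^*\mathcal{M}}{d\mathcal{M}}\bigl(\mathbf{q},F(\mathbf{q},\cdot)^{-1}(\tilde{\mathbf{q}})\bigr)\quad\text{for }\eta\text{-a.e. }(\mathbf{q},\tilde{\mathbf{q}})\in X\times X.$$ (iii) Furthermore, under either of these equivalent absolute continuity conditions, with $$\alpha(\mathbf{q},\tilde{\mathbf{q}})=1\wedge\frac{d\eta^\perp}{d\eta}(\mathbf{q},\tilde{\mathbf{q}}),\qquad\hat\alpha(\mathbf{q},\mathbf{v})=1\wedge\frac{dS^*\mathcal{M}}{d\mathcal{M}}(\mathbf{q},\mathbf{v}),$$ the Markov kernels $$P(\mathbf{q},d\tilde{\mathbf{q}})=\int_Y\hat\alpha(\mathbf{q},\mathbf{v})\,\delta_{\Pi_1\circ S(\mathbf{q},\mathbf{v})}(d\tilde{\mathbf{q}})\,\mathcal{V}(\mathbf{q},d\mathbf{v})+\delta_{\mathbf{q}}(d\tilde{\mathbf{q}})\int_Y(1-\hat\alpha(\mathbf{q},\mathbf{v}))\,\mathcal{V}(\mathbf{q},d\mathbf{v})$$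 and $$\bar P(\mathbf{q},d\tilde{\mathbf{q}})=\alpha(\mathbf{q},\tilde{\mathbf{q}})\,Q(\mathbf{q},d\tilde{\mathbf{q}})+\delta_{\mathbf{q}}(d\tilde{\mathbf{q}})\int_X(1-\alpha(\mathbf{q},\mathbf{r}))\,Q(\mathbf{q},d\mathbf{r})$$ coincide, and the acceptance functions maintain the relationships $$\alpha(\mathbf{q},\tilde{\mathbf{q}})=\hat\alpha(\mathbf{q},F(\mathbf{q},\cdot)^{-1}(\tilde{\mathbf{q}})),\qquad\hat\alpha(\mathbf{q},\mathbf{v})=\alpha(\mathbf{q},F(\mathbf{q},\mathbf{v}))$$ for $\mathbf{q}\in X$, $\tilde{\mathbf{q}}\in X$ and $\mathbf{v}\in Y$.
   Context: $\Pi_1:X\times Y\to X$ is the projection $\Pi_1(\mathbf{q},\mathbf{v})=\mathbf{q}$, and $I$ is the identity map. The pushforward of a measure $\nu$ by a measurable map $\phi$ is $\phi^*\nu(A)=\nu(\phi^{-1}(A))$. $a\wedge b=\min(a,b)$; $\delta_x$ is the Dirac measure at $x$; $d\nu/d\rho$ denotes a Radon–Nikodym derivative. $\eta(d\tilde{\mathbf{q}},d\mathbf{q})$ means the pushforward of $\eta$ by the coordinate swap $(\mathbf{q},\tilde{\mathbf{q}})\mapsto(\tilde{\mathbf{q}},\mathbf{q})$. The inverse of $F(\mathbf{q},\cdot)$ is the map $F(\mathbf{q},\cdot)^{-1}:X\to Y$.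
   Formalization: The inverse is assumed measurable jointly in (q, q̃), since otherwise S may be non-measurable and S*M undefined; the identities in (iii) hold a.e. for arbitrary versions of the derivatives, and everywhere for suitably matched versions. *)

theory Defs
  imports "HOL-Probability.Probability"
begin

text \<open>Markov kernels from \<open>X\<close> to \<open>Y\<close> are elements of \<open>X \<rightarrow>\<^sub>M prob_algebra Y\<close>.\<close>

definition semidirect :: "'a measure \<Rightarrow> ('a \<Rightarrow> 'b measure) \<Rightarrow> 'b measure \<Rightarrow> ('a \<times> 'b) measure" where
  \<comment> \<open>the measure \<open>\<mu>(dx) K(x, dy)\<close>, where \<open>N\<close> carries the sigma-algebra of the second factor\<close>
  "semidirect \<mu> K N = \<mu> \<bind> (\<lambda>x. distr (K x) (\<mu> \<Otimes>\<^sub>M N) (Pair x))"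

text \<open>Sectionwise measurability of \<open>F(q, \<cdot>)\<inverse>\<close> does not imply measurability of
  \<open>(q, r) \<mapsto> F(q, \<cdot>)\<inverse>(r)\<close>, nor even of the involution below, unless the spaces are
  assumed to be, say, standard Borel. Pushing a measure forward along the involution requires it to be
  measurable, so measurability of the inverse is to be imposed jointly in \<open>(q, r)\<close>.\<close>

definition section_inv :: "'b measure \<Rightarrow> ('a \<times> 'b \<Rightarrow> 'a) \<Rightarrow> 'a \<Rightarrow> 'a \<Rightarrow> 'b" where
  "section_inv Y F q = inv_into (space Y) (\<lambda>v. F (q, v))"

definition involution :: "'b measure \<Rightarrow> ('a \<times> 'b \<Rightarrow> 'a) \<Rightarrow> 'a \<times> 'b \<Rightarrow> 'a \<times> 'b" where
  "involution Y F = (\<lambda>(q, v). (F (q, v), section_inv Y F (F (q, v)) q))"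

text \<open>Radon-Nikodym derivatives are only determined almost everywhere. The predicate singles out
  all versions of \<open>dN/dM\<close>; the library's \<^const>\<open>RN_deriv\<close> is one arbitrarily chosen version.\<close>

definition is_RN_deriv :: "'a measure \<Rightarrow> 'a measure \<Rightarrow> ('a \<Rightarrow> ennreal) \<Rightarrow> bool" where
  "is_RN_deriv M N f \<longleftrightarrow> f \<in> borel_measurable M \<and> density M f = N"

lemma (in sigma_finite_measure) is_RN_deriv_RN_deriv:
  assumes "absolutely_continuous M N" "sets N = sets M"
  shows "is_RN_deriv M N (RN_deriv M N)"
  using assms by (simp add: is_RN_deriv_def density_RN_deriv)

definition acceptance :: "('a \<Rightarrow> ennreal) \<Rightarrow> 'a \<Rightarrow> ennreal" where
  "acceptance D z = min 1 (D z)"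

text \<open>In the next two definitions \<^const>\<open>measure_of\<close> would silently return the zero measure if the
  given set function were not a measure. The subtraction on \<^typ>\<open>ennreal\<close> is not truncated for
  acceptance functions, since these are bounded by 1.\<close>

definition extended_kernel ::
  "'a measure \<Rightarrow> ('a \<Rightarrow> 'b measure) \<Rightarrow> ('a \<times> 'b \<Rightarrow> 'a \<times> 'b) \<Rightarrow> ('a \<times> 'b \<Rightarrow> ennreal) \<Rightarrow> 'a \<Rightarrow> 'a measure"
where
  "extended_kernel X V S a q = measure_of (space X) (sets X)
     (\<lambda>A. (\<integral>\<^sup>+ v. a (q, v) * emeasure (return X (fst (S (q, v)))) A \<partial>V q)
        + emeasure (return X q) A * (\<integral>\<^sup>+ v. (1 - a (q, v)) \<partial>V q))"

definition metropolis_kernel ::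
  "'a measure \<Rightarrow> ('a \<Rightarrow> 'a measure) \<Rightarrow> ('a \<times> 'a \<Rightarrow> ennreal) \<Rightarrow> 'a \<Rightarrow> 'a measure"
where
  "metropolis_kernel X Q a q = measure_of (space X) (sets X)
     (\<lambda>A. (\<integral>\<^sup>+ r \<in> A. a (q, r) \<partial>Q q)
        + emeasure (return X q) A * (\<integral>\<^sup>+ r. (1 - a (q, r)) \<partial>Q q))"

end

theory Submission imports Defs begin

text \<open>The map \<open>(q, v) \<mapsto> (q, F (q, v))\<close> is an isomorphism of measurable spaces from \<open>X \<times> Y\<close>
  onto \<open>X \<times> X\<close>. It pushes \<open>M\<close> forward to \<open>\<eta>\<close> and conjugates the involution \<open>S\<close> to the
  coordinate swap, so it also pushes \<open>S\<^sup>*M\<close> forward to \<open>\<eta>'\<close>. Absolute continuity and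
  Radon-Nikodym derivatives are transported along such an isomorphism, and changing variables in
  the accept-reject integrals identifies the two kernels.\<close>

section \<open>Transport of absolute continuity and densities along measurable maps\<close>

lemma absolutely_continuous_distr:
  assumes "absolutely_continuous M N" "sets N = sets M" "f \<in> M \<rightarrow>\<^sub>M R"
  shows "absolutely_continuous (distr M R f) (distr N R f)"
proof -
  have "f \<in> N \<rightarrow>\<^sub>M R" "space N = space M"
    using assms measurable_cong_sets[OF assms(2) refl] sets_eq_imp_space_eq[OF assms(2)] by auto
  then show ?thesis
    using assms by (auto simp: absolutely_continuous_def null_sets_distr_iff)
qed

text \<open>Since \<open>g\<close> undoes \<open>f\<close>, the function \<open>h \<circ> g\<close>
  pulls back along \<open>f\<close> to \<open>h\<close> on \<open>space M\<close>. Weighting after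
  the pushforward is therefore the same as pushing forward the weighted measure. The new derivative
  is composed with the inverse map, not with the map being pushed along.\<close>

lemma is_RN_deriv_distr:
  assumes h: "is_RN_deriv M N h" and f: "f \<in> M \<rightarrow>\<^sub>M R" and g: "g \<in> R \<rightarrow>\<^sub>M M"
    and gf: "\<And>x. x \<in> space M \<Longrightarrow> g (f x) = x"
  shows "is_RN_deriv (distr M R f) (distr N R f) (h \<circ> g)"
proof -
  have hm: "h \<in> borel_measurable M" and N: "N = density M h"
    using h by (auto simp: is_RN_deriv_def)
  have hg: "h \<circ> g \<in> borel_measurable R"
    using g hm by (rule measurable_comp)
  have "density (distr M R f) (h \<circ> g) = distr (density M (\<lambda>x. (h \<circ> g) (f x))) R f"
    using hg f by (rule density_distr)
  also have "density M (\<lambda>x. (h \<circ> g) (f x)) = N"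
    unfolding N using hm measurable_comp[OF f hg] gf
    by (intro density_cong) (auto simp: comp_def)
  finally show ?thesis
    using hg by (simp add: is_RN_deriv_def comp_def)
qed

lemma (in sigma_finite_measure) is_RN_deriv_unique:
  assumes "is_RN_deriv M N f" "is_RN_deriv M N g"
  shows "AE x in M. f x = g x"
  using assms by (intro density_unique) (auto simp: is_RN_deriv_def)

section \<open>Semidirect products of a probability measure with a Markov kernel\<close>

lemma sets_prob_kernel: "K \<in> X \<rightarrow>\<^sub>M prob_algebra N \<Longrightarrow> q \<in> space X \<Longrightarrow> sets (K q) = sets N"
  by (rule sets_kernel[OF measurable_prob_algebraD])

text \<open>This is the kernel bound to \<open>\<mu>\<close> in \<open>semidirect\<close>. All bind
  rules below ask for its measurability over \<open>\<mu>\<close>, whereas \<open>K\<close> is given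
  over \<open>X\<close>; the two sigma-algebras agree.\<close>

lemma measurable_Pair_kernel:
  assumes "sets \<mu> = sets X" "K \<in> X \<rightarrow>\<^sub>M prob_algebra N"
  shows "(\<lambda>x. distr (K x) (\<mu> \<Otimes>\<^sub>M N) (Pair x)) \<in> \<mu> \<rightarrow>\<^sub>M prob_algebra (\<mu> \<Otimes>\<^sub>M N)"
proof -
  have [measurable]: "K \<in> \<mu> \<rightarrow>\<^sub>M prob_algebra N"
    using assms by (simp cong: measurable_cong_sets)
  show ?thesis by measurable
qed

context
  fixes \<mu> X :: "'a measure" and K :: "'a \<Rightarrow> 'b measure" and N :: "'b measure"
  assumes \<mu>: "prob_space \<mu>" "sets \<mu> = sets X" and K: "K \<in> X \<rightarrow>\<^sub>M prob_algebra N"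
begin

lemma in_space_prob_algebra_marginal: "\<mu> \<in> space (prob_algebra \<mu>)"
  using \<mu> by (simp add: space_prob_algebra)

lemma prob_space_semidirect: "prob_space (semidirect \<mu> K N)"
  unfolding semidirect_def
  by (rule prob_space_bind'[OF in_space_prob_algebra_marginal measurable_Pair_kernel[OF \<mu>(2) K]])

lemma sets_semidirect: "sets (semidirect \<mu> K N) = sets (X \<Otimes>\<^sub>M N)"
proof -
  have "sets (semidirect \<mu> K N) = sets (\<mu> \<Otimes>\<^sub>M N)"
    unfolding semidirect_def
    by (rule sets_bind'[OF in_space_prob_algebra_marginal measurable_Pair_kernel[OF \<mu>(2) K]])
  also have "\<dots> = sets (X \<Otimes>\<^sub>M N)"
    using \<mu>(2) by (intro sets_pair_measure_cong refl)
  finally show ?thesis .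
qed

text \<open>Fubini for null sets. It serves to turn equality of derivatives almost everywhere on the
  product into equality along almost every fibre, the form in which kernels can be compared.\<close>

lemma AE_semidirect:
  assumes P: "Measurable.pred (X \<Otimes>\<^sub>M N) P" and ae: "AE z in semidirect \<mu> K N. P z"
  shows "AE q in \<mu>. AE v in K q. P (q, v)"
proof -
  have sets_eq: "sets (\<mu> \<Otimes>\<^sub>M N) = sets (X \<Otimes>\<^sub>M N)"
    using \<mu>(2) by (intro sets_pair_measure_cong refl)
  have P': "Measurable.pred (\<mu> \<Otimes>\<^sub>M N) P"
    using P measurable_cong_sets[OF sets_eq refl] by blast
  have ae_distr: "AE q in \<mu>. AE z in distr (K q) (\<mu> \<Otimes>\<^sub>M N) (Pair q). P z"
    using ae unfolding semidirect_def
    by (subst (asm) AE_bind[OF measurable_prob_algebraD[OF measurable_Pair_kernel[OF \<mu>(2) K]] P'])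
  show ?thesis
  proof (rule AE_mp[OF ae_distr], rule AE_I2, rule impI)
    fix q assume q: "q \<in> space \<mu>" and "AE z in distr (K q) (\<mu> \<Otimes>\<^sub>M N) (Pair q). P z"
    moreover have "sets (K q) = sets N"
      using K q sets_eq_imp_space_eq[OF \<mu>(2)] by (simp add: sets_prob_kernel)
    then have "Pair q \<in> K q \<rightarrow>\<^sub>M \<mu> \<Otimes>\<^sub>M N"
      using measurable_Pair1'[OF q, of N] by (simp cong: measurable_cong_sets)
    ultimately show "AE v in K q. P (q, v)"
      using P' by (subst (asm) AE_distr_iff) (auto simp: pred_def)
  qed
qed

text \<open>The map leaves the first coordinate alone, so the pushforward passes through the bind
  and acts on each fibre separately. With \<open>f q v = F (q, v)\<close> it exhibits \<eta> as the
  image of \<open>M\<close>.\<close>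

lemma distr_semidirect:
  assumes f: "(\<lambda>(q, v). f q v) \<in> X \<Otimes>\<^sub>M N \<rightarrow>\<^sub>M R"
  shows "distr (semidirect \<mu> K N) (X \<Otimes>\<^sub>M R) (\<lambda>(q, v). (q, f q v))
    = semidirect \<mu> (\<lambda>q. distr (K q) R (f q)) R"
proof -
  have sets_eq: "sets (\<mu> \<Otimes>\<^sub>M N) = sets (X \<Otimes>\<^sub>M N)"
    and sets_eq': "sets (\<mu> \<Otimes>\<^sub>M R) = sets (X \<Otimes>\<^sub>M R)"
    using \<mu>(2) by (auto intro: sets_pair_measure_cong)
  have fm [measurable]: "(\<lambda>(q, v). f q v) \<in> \<mu> \<Otimes>\<^sub>M N \<rightarrow>\<^sub>M R"
    using f measurable_cong_sets[OF sets_eq refl] by blast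
  have graph: "(\<lambda>(q, v). (q, f q v)) \<in> \<mu> \<Otimes>\<^sub>M N \<rightarrow>\<^sub>M X \<Otimes>\<^sub>M R"
    unfolding measurable_cong_sets[OF refl sets_eq'[symmetric]] by measurable
  have "distr (semidirect \<mu> K N) (X \<Otimes>\<^sub>M R) (\<lambda>(q, v). (q, f q v)) =
      \<mu> \<bind> (\<lambda>q. distr (distr (K q) (\<mu> \<Otimes>\<^sub>M N) (Pair q)) (X \<Otimes>\<^sub>M R) (\<lambda>(q, v). (q, f q v)))"
    unfolding semidirect_def
    using prob_space.not_empty[OF \<mu>(1)]
    by (intro distr_bind[OF measurable_prob_algebraD[OF measurable_Pair_kernel[OF \<mu>(2) K]] _ graph])
  also have "\<dots> = semidirect \<mu> (\<lambda>q. distr (K q) R (f q)) R"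
    unfolding semidirect_def
  proof (intro bind_cong refl)
    fix q assume q: "q \<in> space \<mu>"
    have "sets (K q) = sets N"
      using K q sets_eq_imp_space_eq[OF \<mu>(2)] by (simp add: sets_prob_kernel)
    note meas_K = measurable_cong_sets[OF this refl]
    have Pair_q: "Pair q \<in> K q \<rightarrow>\<^sub>M \<mu> \<Otimes>\<^sub>M N"
      unfolding meas_K by (rule measurable_Pair1'[OF q])
    have f_q: "f q \<in> K q \<rightarrow>\<^sub>M R"
      unfolding meas_K using measurable_Pair2[OF fm q] by (simp only: case_prod_conv)
    have "distr (distr (K q) R (f q)) (\<mu> \<Otimes>\<^sub>M R) (Pair q) =
        distr (K q) (\<mu> \<Otimes>\<^sub>M R) (Pair q \<circ> f q)"
      using q by (intro distr_distr f_q measurable_Pair1')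
    \<comment> \<open>Both composites send \<open>v\<close> to \<open>(q, f q v)\<close>; the target
      only changes to a measure space with the same sigma-algebra.\<close>
    also have "\<dots> = distr (K q) (X \<Otimes>\<^sub>M R) ((\<lambda>(q, v). (q, f q v)) \<circ> Pair q)"
      by (intro distr_cong sets_eq') auto
    also have "\<dots> = distr (distr (K q) (\<mu> \<Otimes>\<^sub>M N) (Pair q)) (X \<Otimes>\<^sub>M R) (\<lambda>(q, v). (q, f q v))"
      by (rule distr_distr[OF graph Pair_q, symmetric])
    finally show "distr (distr (K q) (\<mu> \<Otimes>\<^sub>M N) (Pair q)) (X \<Otimes>\<^sub>M R) (\<lambda>(q, v). (q, f q v)) =
        distr (distr (K q) R (f q)) (\<mu> \<Otimes>\<^sub>M R) (Pair q)"
      by (rule sym)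
  qed
  finally show ?thesis .
qed

end

section \<open>Accept-reject kernels\<close>

lemma sets_extended_kernel [simp]: "sets (extended_kernel X V S a q) = sets X"
  by (simp add: extended_kernel_def)

text \<open>The acceptance function enters only through integrals against \<open>V q\<close>, so the
  set functions handed to \<open>measure_of\<close> are equal. This is how a change of version of
  the derivative is absorbed.\<close>

lemma extended_kernel_cong_AE:
  assumes "AE v in V q. a (q, v) = b (q, v)"
  shows "extended_kernel X V S a q = extended_kernel X V S b q"
proof -
  have "(\<integral>\<^sup>+ v. a (q, v) * emeasure (return X (fst (S (q, v)))) A \<partial>V q)
      = (\<integral>\<^sup>+ v. b (q, v) * emeasure (return X (fst (S (q, v)))) A \<partial>V q)" for A
    using assms by (intro nn_integral_cong_AE) auto
  moreover have "(\<integral>\<^sup>+ v. (1 - a (q, v)) \<partial>V q) = (\<integral>\<^sup>+ v. (1 - b (q, v)) \<partial>V q)"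
    using assms by (intro nn_integral_cong_AE) auto
  ultimately show ?thesis
    by (simp add: extended_kernel_def)
qed

context
  fixes X :: "'a measure" and Y :: "'b measure" and V and S :: "'a \<times> 'b \<Rightarrow> 'a \<times> 'b" and a :: "'a \<times> 'b \<Rightarrow> ennreal"
  assumes V [measurable]: "V \<in> X \<rightarrow>\<^sub>M prob_algebra Y"
    and S [measurable]: "(\<lambda>z. fst (S z)) \<in> X \<Otimes>\<^sub>M Y \<rightarrow>\<^sub>M X"
    and a [measurable]: "a \<in> borel_measurable (X \<Otimes>\<^sub>M Y)"
begin

lemma borel_measurable_section:
  assumes q: "q \<in> space X"
  shows "(\<lambda>v. a (q, v)) \<in> borel_measurable (V q)"
  using measurable_Pair2[OF a q] measurable_cong_sets[OF sets_prob_kernel[OF V q] refl] by blast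

text \<open>The value can be read off from \<open>measure_of\<close> only once the set function is
  known to be a measure. The substance is countable additivity, inherited from the Dirac masses by
  exchanging sum and integral.\<close>

lemma emeasure_extended_kernel:
  assumes q: "q \<in> space X" and A: "A \<in> sets X"
  shows "emeasure (extended_kernel X V S a q) A =
    (\<integral>\<^sup>+ v. a (q, v) * indicator A (fst (S (q, v))) \<partial>V q)
      + indicator A q * (\<integral>\<^sup>+ v. (1 - a (q, v)) \<partial>V q)"
proof -
  let ?m = "\<lambda>A. (\<integral>\<^sup>+ v. a (q, v) * emeasure (return X (fst (S (q, v)))) A \<partial>V q)
        + emeasure (return X q) A * (\<integral>\<^sup>+ v. (1 - a (q, v)) \<partial>V q)"
  note [measurable_cong] = sets_prob_kernel[OF V q]
  have [measurable]: "(\<lambda>v. fst (S (q, v))) \<in> V q \<rightarrow>\<^sub>M X"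
    using measurable_Pair2[OF S q] measurable_cong_sets[OF sets_prob_kernel[OF V q] refl] by blast
  note [measurable] = borel_measurable_section[OF q]
  have "countably_additive (sets X) ?m"
  proof (rule countably_additiveI)
    fix B :: "nat \<Rightarrow> 'a set"
    assume B: "range B \<subseteq> sets X" "disjoint_family B" "(\<Union>i. B i) \<in> sets X"
    have [measurable]: "B i \<in> sets X" for i
      using B by auto
    have ret: "emeasure (return X x) (\<Union>i. B i) = (\<Sum>i. emeasure (return X x) (B i))" for x
      using B by (intro suminf_emeasure[symmetric]) auto
    have "(\<integral>\<^sup>+ v. a (q, v) * emeasure (return X (fst (S (q, v)))) (\<Union>i. B i) \<partial>V q)
        = (\<Sum>i. \<integral>\<^sup>+ v. a (q, v) * emeasure (return X (fst (S (q, v)))) (B i) \<partial>V q)"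
      by (simp add: ret flip: ennreal_suminf_cmult) (intro nn_integral_suminf, measurable)
    then show "(\<Sum>i. ?m (B i)) = ?m (\<Union>i. B i)"
      by (simp add: ret flip: suminf_add)
  qed
  moreover have "positive (sets X) ?m"
    by (simp add: positive_def)
  ultimately have "emeasure (extended_kernel X V S a q) A = ?m A"
    using A by (intro emeasure_measure_of[OF extended_kernel_def]) (auto dest: sets.sets_into_space)
  then show ?thesis
    using A by simp
qed

text \<open>The bound by 1 makes \<open>a + (1 - a) = 1\<close> hold in \<open>ennreal\<close>, so
  accepted and rejected mass add up to 1. Measurability in \<open>q\<close> is that of integrals
  against the kernel \<open>V\<close>.\<close>

lemma measurable_extended_kernel:
  assumes a1: "\<And>z. a z \<le> 1"
  shows "extended_kernel X V S a \<in> X \<rightarrow>\<^sub>M prob_algebra X"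
proof -
  note V' [measurable] = measurable_prob_algebraD[OF V]
  have prob: "prob_space (extended_kernel X V S a q)" if q: "q \<in> space X" for q
  proof -
    have V_q: "prob_space (V q)" and sets_V: "sets (V q) = sets Y"
      using measurable_space[OF V q] by (auto simp: space_prob_algebra)
    note [measurable] = borel_measurable_section[OF q]
    \<comment> \<open>Every proposal lands in \<open>space X\<close>, so no accepted mass is lost
      when the kernel is evaluated on the whole space.\<close>
    have "fst (S (q, v)) \<in> space X" if "v \<in> space (V q)" for v
      using that q measurable_space[OF S, of "(q, v)"] sets_eq_imp_space_eq[OF sets_V]
      by (simp add: space_pair_measure)
    then have "emeasure (extended_kernel X V S a q) (space X)
        = (\<integral>\<^sup>+ v. a (q, v) \<partial>V q) + (\<integral>\<^sup>+ v. (1 - a (q, v)) \<partial>V q)"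
      using q by (simp add: emeasure_extended_kernel cong: nn_integral_cong)
    also have "\<dots> = (\<integral>\<^sup>+ v. (a (q, v) + (1 - a (q, v))) \<partial>V q)"
      by (intro nn_integral_add[symmetric]) measurable
    also have "\<dots> = 1"
      using prob_space.emeasure_space_1[OF V_q] by (simp add: add_diff_inverse_ennreal a1)
    finally show ?thesis
      by (intro prob_spaceI) (simp add: sets_eq_imp_space_eq[OF sets_extended_kernel])
  qed
  have "extended_kernel X V S a \<in> X \<rightarrow>\<^sub>M subprob_algebra X"
  proof (rule measurable_subprob_algebra)
    fix A assume [measurable]: "A \<in> sets X"
    have [measurable]:
      "(\<lambda>q. \<integral>\<^sup>+ v. a (q, v) * indicator A (fst (S (q, v))) \<partial>V q) \<in> borel_measurable X"
      "(\<lambda>q. \<integral>\<^sup>+ v. (1 - a (q, v)) \<partial>V q) \<in> borel_measurable X"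
      by (intro nn_integral_measurable_subprob_algebra2[OF _ V'], measurable)+
    show "(\<lambda>q. emeasure (extended_kernel X V S a q) A) \<in> borel_measurable X"
      by (simp add: emeasure_extended_kernel cong: measurable_cong)
  qed (use prob in \<open>auto intro: prob_space_imp_subprob_space\<close>)
  with prob show ?thesis
    by (rule measurable_prob_algebraI)
qed

end

text \<open>Substituting \<open>r = F (q, v)\<close> turns integrals against the proposal law into
  integrals against \<open>V q\<close>. The set functions agree on \<open>sets X\<close>, so
  \<open>measure_of\<close> gives the same result, and the properties of
  \<open>extended_kernel\<close> carry over to \<open>metropolis_kernel\<close>.\<close>

lemma metropolis_kernel_distr:
  assumes f: "(\<lambda>v. F (q, v)) \<in> V q \<rightarrow>\<^sub>M X" and a: "(\<lambda>r. a (q, r)) \<in> borel_measurable X"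
    and S: "\<And>v. v \<in> space (V q) \<Longrightarrow> fst (S (q, v)) = F (q, v)"
  shows "metropolis_kernel X (\<lambda>q. distr (V q) X (\<lambda>v. F (q, v))) a q
    = extended_kernel X V S (\<lambda>(q, v). a (q, F (q, v))) q"
  unfolding metropolis_kernel_def extended_kernel_def
proof (rule measure_of_eq[OF sets.space_closed])
  fix A assume "A \<in> sigma_sets (space X) (sets X)"
  then have A [measurable]: "A \<in> sets X"
    by (simp add: sets.sigma_sets_eq)
  note [measurable] = f a
  have "(\<integral>\<^sup>+ r \<in> A. a (q, r) \<partial>distr (V q) X (\<lambda>v. F (q, v)))
      = (\<integral>\<^sup>+ v. a (q, F (q, v)) * emeasure (return X (fst (S (q, v)))) A \<partial>V q)"
    using A S by (simp add: nn_integral_distr cong: nn_integral_cong)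
  moreover have "(\<integral>\<^sup>+ r. (1 - a (q, r)) \<partial>distr (V q) X (\<lambda>v. F (q, v)))
      = (\<integral>\<^sup>+ v. (1 - a (q, F (q, v))) \<partial>V q)"
    by (simp add: nn_integral_distr)
  ultimately show "(\<integral>\<^sup>+ r \<in> A. a (q, r) \<partial>distr (V q) X (\<lambda>v. F (q, v)))
        + emeasure (return X q) A * (\<integral>\<^sup>+ r. (1 - a (q, r)) \<partial>distr (V q) X (\<lambda>v. F (q, v)))
      = (\<integral>\<^sup>+ v. (case (q, v) of (q, v) \<Rightarrow> a (q, F (q, v))) * emeasure (return X (fst (S (q, v)))) A \<partial>V q)
        + emeasure (return X q) A * (\<integral>\<^sup>+ v. (1 - (case (q, v) of (q, v) \<Rightarrow> a (q, F (q, v)))) \<partial>V q)"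
    by simp
qed

section \<open>Inverses of the sections and the involution\<close>

lemma
  assumes bij: "bij_betw (\<lambda>v. F (q, v)) (space Y) (space X)"
  shows F_section_inv: "r \<in> space X \<Longrightarrow> F (q, section_inv Y F q r) = r"
    and section_inv_F: "v \<in> space Y \<Longrightarrow> section_inv Y F q (F (q, v)) = v"
    and section_inv_space: "r \<in> space X \<Longrightarrow> section_inv Y F q r \<in> space Y"
  using bij by (auto simp: section_inv_def bij_betw_def f_inv_into_f[where f = "\<lambda>v. F (q, v)"]
      inv_into_f_f[where f = "\<lambda>v. F (q, v)"] intro: inv_into_into)

text \<open>The involution law is two cancellations: with \<open>r = F (q, v)\<close>, applying
  \<open>F\<close> to \<open>(r, section_inv Y F r q)\<close> gives back \<open>q\<close>, and then
  \<open>section_inv Y F q r\<close> gives back \<open>v\<close>.\<close>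

lemma
  assumes F: "\<And>z. z \<in> space (X \<Otimes>\<^sub>M Y) \<Longrightarrow> F z \<in> space X"
    and bij: "\<And>q. q \<in> space X \<Longrightarrow> bij_betw (\<lambda>v. F (q, v)) (space Y) (space X)"
  shows involution_space: "involution Y F \<in> space (X \<Otimes>\<^sub>M Y) \<rightarrow> space (X \<Otimes>\<^sub>M Y)"
    and fst_involution: "fst (involution Y F z) = F z"
    and involution_involution: "z \<in> space (X \<Otimes>\<^sub>M Y) \<Longrightarrow> involution Y F (involution Y F z) = z"
    and involution_unique: "T \<in> space (X \<Otimes>\<^sub>M Y) \<rightarrow> space (X \<Otimes>\<^sub>M Y) \<Longrightarrow>
      (\<And>z. z \<in> space (X \<Otimes>\<^sub>M Y) \<Longrightarrow> fst (T z) = F z \<and> T (T z) = z) \<Longrightarrow>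
      z \<in> space (X \<Otimes>\<^sub>M Y) \<Longrightarrow> T z = involution Y F z"
proof -
  show "involution Y F \<in> space (X \<Otimes>\<^sub>M Y) \<rightarrow> space (X \<Otimes>\<^sub>M Y)"
    using F section_inv_space[OF bij] by (auto simp: involution_def space_pair_measure)
  show "fst (involution Y F z) = F z"
    by (simp add: involution_def split: prod.split)
  show "involution Y F (involution Y F z) = z" if "z \<in> space (X \<Otimes>\<^sub>M Y)"
    using that F F_section_inv[OF bij] section_inv_F[OF bij]
    by (auto simp: involution_def space_pair_measure)
  assume T: "T \<in> space (X \<Otimes>\<^sub>M Y) \<rightarrow> space (X \<Otimes>\<^sub>M Y)"
    and T': "\<And>z. z \<in> space (X \<Otimes>\<^sub>M Y) \<Longrightarrow> fst (T z) = F z \<and> T (T z) = z"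
    and z: "z \<in> space (X \<Otimes>\<^sub>M Y)"
  obtain q v where qv: "z = (q, v)"
    by (cases z)
  have Tz: "T z \<in> space (X \<Otimes>\<^sub>M Y)"
    using T z by auto
  obtain w where w: "T z = (F z, w)" "w \<in> space Y"
    using T'[OF z] Tz by (cases "T z") (auto simp: space_pair_measure)
  \<comment> \<open>The first coordinate of \<open>T (T z)\<close> is \<open>F (T z)\<close>, and
    \<open>T (T z)\<close> is \<open>z\<close>. Injectivity of the section of \<open>F\<close> at
    \<open>F z\<close> then determines \<open>w\<close>.\<close>
  have "F (F z, w) = q"
    using T'[OF Tz] T'[OF z] w qv by auto
  then show "T z = involution Y F z"
    using w section_inv_F[OF bij[OF F[OF z]], of w] by (simp add: qv involution_def)
qed

text \<open>Derivatives are fixed only almost everywhere, so the last claim takes two forms: almost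
  everywhere for arbitrary versions \<open>D\<close> and \<open>E\<close>, and at every point once
  the version on one side is chosen to match a given version on the other. Uniqueness of the
  involution is among self-maps of the product space.\<close>

theorem theorem3p4:
  fixes X :: "'a measure" and Y :: "'b measure" and \<mu> :: "'a measure"
    and V :: "'a \<Rightarrow> 'b measure" and F :: "'a \<times> 'b \<Rightarrow> 'a"
  assumes \<mu>: "prob_space \<mu>" "sets \<mu> = sets X"
    and V: "V \<in> X \<rightarrow>\<^sub>M prob_algebra Y"
    and F: "F \<in> X \<Otimes>\<^sub>M Y \<rightarrow>\<^sub>M X"
    and F_bij: "\<And>q. q \<in> space X \<Longrightarrow> bij_betw (\<lambda>v. F (q, v)) (space Y) (space X)"
    and F_inv: "(\<lambda>(q, r). section_inv Y F q r) \<in> X \<Otimes>\<^sub>M X \<rightarrow>\<^sub>M Y"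
  defines "Q \<equiv> \<lambda>q. distr (V q) X (\<lambda>v. F (q, v))"
  defines "\<eta> \<equiv> semidirect \<mu> Q X"
  defines "\<eta>' \<equiv> distr \<eta> (X \<Otimes>\<^sub>M X) (\<lambda>(q, r). (r, q))"
  defines "S \<equiv> involution Y F"
  defines "M \<equiv> semidirect \<mu> V Y"
  defines "SM \<equiv> distr M (X \<Otimes>\<^sub>M Y) S"
  defines "P \<equiv> \<lambda>E. extended_kernel X V S (acceptance E)"
  defines "P' \<equiv> \<lambda>D. metropolis_kernel X Q (acceptance D)"
  shows
    "(S \<in> space (X \<Otimes>\<^sub>M Y) \<rightarrow> space (X \<Otimes>\<^sub>M Y)
     \<and> (\<forall>z \<in> space (X \<Otimes>\<^sub>M Y). fst (S z) = F z \<and> S (S z) = z)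
     \<and> (\<forall>T \<in> space (X \<Otimes>\<^sub>M Y) \<rightarrow> space (X \<Otimes>\<^sub>M Y).
          (\<forall>z \<in> space (X \<Otimes>\<^sub>M Y). fst (T z) = F z \<and> T (T z) = z)
          \<longrightarrow> (\<forall>z \<in> space (X \<Otimes>\<^sub>M Y). T z = S z)))
   \<and> (absolutely_continuous \<eta> \<eta>' \<longleftrightarrow> absolutely_continuous M SM)
   \<and> (absolutely_continuous \<eta> \<eta>' \<or> absolutely_continuous M SM \<longrightarrow>
      (\<forall>D E. is_RN_deriv \<eta> \<eta>' D \<longrightarrow> is_RN_deriv M SM E \<longrightarrow>
         (AE (q, v) in M. D (q, F (q, v)) = E (q, v))
       \<and> (AE (q, r) in \<eta>. D (q, r) = E (q, section_inv Y F q r))))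
   \<and> (absolutely_continuous \<eta> \<eta>' \<or> absolutely_continuous M SM \<longrightarrow>
      (\<forall>D E. is_RN_deriv \<eta> \<eta>' D \<longrightarrow> is_RN_deriv M SM E \<longrightarrow>
         P E \<in> X \<rightarrow>\<^sub>M prob_algebra X \<and> P' D \<in> X \<rightarrow>\<^sub>M prob_algebra X
       \<and> (AE q in \<mu>. P E q = P' D q)
       \<and> (AE (q, r) in \<eta>. acceptance D (q, r) = acceptance E (q, section_inv Y F q r))
       \<and> (AE (q, v) in M. acceptance E (q, v) = acceptance D (q, F (q, v))))
     \<and> (\<forall>D. is_RN_deriv \<eta> \<eta>' D \<longrightarrow> (\<exists>E. is_RN_deriv M SM E
         \<and> (\<forall>q \<in> space X. P E q = P' D q)
         \<and> (\<forall>q \<in> space X. \<forall>r \<in> space X.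
              acceptance D (q, r) = acceptance E (q, section_inv Y F q r))
         \<and> (\<forall>q \<in> space X. \<forall>v \<in> space Y. acceptance E (q, v) = acceptance D (q, F (q, v)))))
     \<and> (\<forall>E. is_RN_deriv M SM E \<longrightarrow> (\<exists>D. is_RN_deriv \<eta> \<eta>' D
         \<and> (\<forall>q \<in> space X. P E q = P' D q)
         \<and> (\<forall>q \<in> space X. \<forall>r \<in> space X.
              acceptance D (q, r) = acceptance E (q, section_inv Y F q r))
         \<and> (\<forall>q \<in> space X. \<forall>v \<in> space Y. acceptance E (q, v) = acceptance D (q, F (q, v))))))"
proof -

  \<comment> \<open>The isomorphism and its inverse\<close>
  define \<phi> where "\<phi> = (\<lambda>(q, v). (q, F (q, v)))"
  define \<psi> where "\<psi> = (\<lambda>(q, r). (q, section_inv Y F q r))"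
  note [measurable] = F F_inv
  have F': "(\<lambda>(q, v). F (q, v)) \<in> X \<Otimes>\<^sub>M Y \<rightarrow>\<^sub>M X"
    using F by simp
  have \<phi> [measurable]: "\<phi> \<in> X \<Otimes>\<^sub>M Y \<rightarrow>\<^sub>M X \<Otimes>\<^sub>M X"
    unfolding \<phi>_def by measurable
  have \<psi> [measurable]: "\<psi> \<in> X \<Otimes>\<^sub>M X \<rightarrow>\<^sub>M X \<Otimes>\<^sub>M Y"
    unfolding \<psi>_def by measurable
  have F_space: "F z \<in> space X" if "z \<in> space (X \<Otimes>\<^sub>M Y)" for z
    using measurable_space[OF F that] .
  have \<psi>\<phi>: "\<psi> (\<phi> z) = z" if "z \<in> space (X \<Otimes>\<^sub>M Y)" for z
    using that section_inv_F[OF F_bij] by (auto simp: \<phi>_def \<psi>_def space_pair_measure)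
  have \<phi>\<psi>: "\<phi> (\<psi> z) = z" if "z \<in> space (X \<Otimes>\<^sub>M X)" for z
    using that F_section_inv[OF F_bij] by (auto simp: \<phi>_def \<psi>_def space_pair_measure)
  \<comment> \<open>This holds on all pairs by unfolding: the swap of \<open>(q, F (q, v))\<close>
    is \<open>(F (q, v), q)\<close>, and \<psi> inverts the section at its first entry.
    Measurability of \<open>S\<close> follows from it.\<close>
  have S_eq: "S = (\<lambda>z. \<psi> (prod.swap (\<phi> z)))"
    by (auto simp: S_def involution_def \<phi>_def \<psi>_def fun_eq_iff)
  have swap [measurable]: "prod.swap \<in> X \<Otimes>\<^sub>M X \<rightarrow>\<^sub>M X \<Otimes>\<^sub>M X"
    unfolding prod.swap_def by measurable
  have S [measurable]: "S \<in> X \<Otimes>\<^sub>M Y \<rightarrow>\<^sub>M X \<Otimes>\<^sub>M Y"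
    unfolding S_eq by measurable
  have fst_S: "fst (S z) = F z" for z
    unfolding S_def by (rule fst_involution[OF F_space F_bij])

  \<comment> \<open>The four measures as images of one another\<close>
  have M: "prob_space M" "sets M = sets (X \<Otimes>\<^sub>M Y)"
    unfolding M_def by (rule prob_space_semidirect[OF \<mu> V] sets_semidirect[OF \<mu> V])+
  have \<eta>_M: "\<eta> = distr M (X \<Otimes>\<^sub>M X) \<phi>"
    unfolding \<eta>_def M_def Q_def \<phi>_def by (rule distr_semidirect[OF \<mu> V F', symmetric])
  have \<eta>: "prob_space \<eta>" "sets \<eta> = sets (X \<Otimes>\<^sub>M X)"
    unfolding \<eta>_M using M \<phi> by (auto intro!: prob_space.prob_space_distr cong: measurable_cong_sets)
  note space_M = sets_eq_imp_space_eq[OF M(2)] and space_\<eta> = sets_eq_imp_space_eq[OF \<eta>(2)]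
  have meas_M: "M \<rightarrow>\<^sub>M L = X \<Otimes>\<^sub>M Y \<rightarrow>\<^sub>M L" for L :: "'c measure"
    by (rule measurable_cong_sets[OF M(2) refl])
  have meas_M': "L \<rightarrow>\<^sub>M M = L \<rightarrow>\<^sub>M X \<Otimes>\<^sub>M Y" for L :: "'c measure"
    by (rule measurable_cong_sets[OF refl M(2)])
  have meas_\<eta>: "\<eta> \<rightarrow>\<^sub>M L = X \<Otimes>\<^sub>M X \<rightarrow>\<^sub>M L" for L :: "'c measure"
    by (rule measurable_cong_sets[OF \<eta>(2) refl])
  have meas_\<eta>': "L \<rightarrow>\<^sub>M \<eta> = L \<rightarrow>\<^sub>M X \<Otimes>\<^sub>M X" for L :: "'c measure"
    by (rule measurable_cong_sets[OF refl \<eta>(2)])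
  have "(\<lambda>(q, r). (r, q)) = (prod.swap :: 'a \<times> 'a \<Rightarrow> 'a \<times> 'a)"
    by auto
  then have "\<eta>' = distr M (X \<Otimes>\<^sub>M X) (prod.swap \<circ> \<phi>)"
    unfolding \<eta>'_def \<eta>_M by (simp add: distr_distr meas_M)
  \<comment> \<open>Conjugacy: \<open>\<phi> \<circ> S\<close> is \<phi> after \<psi> after the
    swapped \<phi>, and \<phi> cancels \<psi> on \<open>X \<Otimes>\<^sub>M X\<close>.\<close>
  also have "\<dots> = distr M (X \<Otimes>\<^sub>M X) (\<phi> \<circ> S)"
  proof (intro distr_cong refl)
    fix z assume "z \<in> space M"
    then have "prod.swap (\<phi> z) \<in> space (X \<Otimes>\<^sub>M X)"
      using measurable_space[OF \<phi>] measurable_space[OF swap] space_M by blast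
    then show "(prod.swap \<circ> \<phi>) z = (\<phi> \<circ> S) z"
      by (simp add: S_eq \<phi>\<psi>)
  qed
  also have "\<dots> = distr SM (X \<Otimes>\<^sub>M X) \<phi>"
    unfolding SM_def by (simp add: distr_distr meas_M)
  finally have \<eta>'_SM: "\<eta>' = distr SM (X \<Otimes>\<^sub>M X) \<phi>" .
  have sets_SM: "sets SM = sets (X \<Otimes>\<^sub>M Y)" and sets_\<eta>': "sets \<eta>' = sets (X \<Otimes>\<^sub>M X)"
    by (simp_all add: SM_def \<eta>'_def)
  \<comment> \<open>Taking \<open>N\<close> to be \<open>M\<close> and \<open>SM\<close> reverses
    the two image identities, so each transport lemma can be applied in both directions.\<close>
  have distr_\<psi>\<phi>: "N = distr (distr N (X \<Otimes>\<^sub>M X) \<phi>) (X \<Otimes>\<^sub>M Y) \<psi>" if "sets N = sets (X \<Otimes>\<^sub>M Y)" for N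
  proof -
    have "distr (distr N (X \<Otimes>\<^sub>M X) \<phi>) (X \<Otimes>\<^sub>M Y) \<psi> = distr N (X \<Otimes>\<^sub>M Y) (\<psi> \<circ> \<phi>)"
      by (intro distr_distr \<psi>) (simp add: measurable_cong_sets[OF that refl])
    also have "\<dots> = distr N N (\<lambda>z. z)"
      using that sets_eq_imp_space_eq[OF that] by (intro distr_cong) (auto simp: \<psi>\<phi>)
    finally show ?thesis
      by (simp add: distr_id)
  qed
  have M_\<eta>: "M = distr \<eta> (X \<Otimes>\<^sub>M Y) \<psi>" and SM_\<eta>': "SM = distr \<eta>' (X \<Otimes>\<^sub>M Y) \<psi>"
    unfolding \<eta>_M \<eta>'_SM by (rule distr_\<psi>\<phi>, fact)+

  \<comment> \<open>Transfer of absolute continuity and of derivatives\<close>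
  have ac: "absolutely_continuous \<eta> \<eta>' \<longleftrightarrow> absolutely_continuous M SM"
  proof
    assume "absolutely_continuous \<eta> \<eta>'"
    then show "absolutely_continuous M SM"
      unfolding M_\<eta> SM_\<eta>' by (rule absolutely_continuous_distr) (simp_all add: \<eta> sets_\<eta>' meas_\<eta>)
  next
    assume "absolutely_continuous M SM"
    then show "absolutely_continuous \<eta> \<eta>'"
      unfolding \<eta>_M \<eta>'_SM by (rule absolutely_continuous_distr) (simp_all add: M sets_SM meas_M)
  qed
  \<comment> \<open>The measures move along \<psi>, whose left inverse on
    \<open>X \<Otimes>\<^sub>M X\<close> is \<phi>; hence the composition with \<phi>.
    \<open>RN_\<psi>\<close> is the mirror case.\<close>
  have RN_\<phi>: "is_RN_deriv M SM (D \<circ> \<phi>)" if "is_RN_deriv \<eta> \<eta>' D" for D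
    unfolding M_\<eta> SM_\<eta>' using that
    by (rule is_RN_deriv_distr) (simp_all add: meas_\<eta> meas_\<eta>' space_\<eta> \<phi>\<psi>)
  have RN_\<psi>: "is_RN_deriv \<eta> \<eta>' (E \<circ> \<psi>)" if "is_RN_deriv M SM E" for E
    unfolding \<eta>_M \<eta>'_SM using that
    by (rule is_RN_deriv_distr) (simp_all add: meas_M meas_M' space_M \<psi>\<phi>)
  interpret M: prob_space M by (rule M(1))
  interpret \<eta>: prob_space \<eta> by (rule \<eta>(1))
  \<comment> \<open>\<open>D \<circ> \<phi>\<close> and \<open>E\<close> are two versions of one
    derivative on \<open>M\<close>; on \<eta>, the versions compared are \<open>D\<close> and
    \<open>E \<circ> \<psi>\<close>.\<close>
  have ae_M: "AE (q, v) in M. D (q, F (q, v)) = E (q, v)"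
    if "is_RN_deriv \<eta> \<eta>' D" "is_RN_deriv M SM E" for D E
    using M.is_RN_deriv_unique[OF RN_\<phi>[OF that(1)] that(2)]
    by (simp add: \<phi>_def case_prod_unfold)
  have ae_\<eta>: "AE (q, r) in \<eta>. D (q, r) = E (q, section_inv Y F q r)"
    if "is_RN_deriv \<eta> \<eta>' D" "is_RN_deriv M SM E" for D E
    using \<eta>.is_RN_deriv_unique[OF that(1) RN_\<psi>[OF that(2)]]
    by (simp add: \<psi>_def case_prod_unfold)

  \<comment> \<open>Coincidence of the two kernels\<close>
  have borel_D: "D \<in> borel_measurable (X \<Otimes>\<^sub>M X)" if "is_RN_deriv \<eta> \<eta>' D" for D
    using that by (simp add: is_RN_deriv_def meas_\<eta>)
  have borel_E: "E \<in> borel_measurable (X \<Otimes>\<^sub>M Y)" if "is_RN_deriv M SM E" for E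
    using that by (simp add: is_RN_deriv_def meas_M)
  have borel_acc: "acceptance f \<in> borel_measurable L" if "f \<in> borel_measurable L"
    for f and L :: "'c measure"
    using that unfolding acceptance_def by measurable
  have acc_le: "acceptance f z \<le> 1" for f and z :: 'c
    by (simp add: acceptance_def)
  note sets_V = sets_prob_kernel[OF V]
  \<comment> \<open>For the transported version \<open>D \<circ> \<phi>\<close> the kernels agree at
    every \<open>q\<close>. Exceptional points arise only when it is replaced by another
    version.\<close>
  have P'_eq: "P' D q = P (D \<circ> \<phi>) q" if D: "is_RN_deriv \<eta> \<eta>' D" and q: "q \<in> space X" for D q
  proof -
    have "(\<lambda>v. F (q, v)) \<in> V q \<rightarrow>\<^sub>M X"
      using q by (simp add: measurable_cong_sets[OF sets_V[OF q] refl])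
    moreover have "(\<lambda>r. acceptance D (q, r)) \<in> borel_measurable X"
      using borel_acc[OF borel_D[OF D]] q by simp
    moreover have "acceptance (D \<circ> \<phi>) = (\<lambda>(q, v). acceptance D (q, F (q, v)))"
      by (auto simp: acceptance_def \<phi>_def fun_eq_iff)
    ultimately show ?thesis
      unfolding P_def P'_def Q_def by (simp add: metropolis_kernel_distr fst_S)
  qed
  have P_kernel: "P E \<in> X \<rightarrow>\<^sub>M prob_algebra X" if "is_RN_deriv M SM E" for E
    unfolding P_def
    by (rule measurable_extended_kernel[OF V _ borel_acc[OF borel_E[OF that]] acc_le]) (simp add: fst_S)
  have P'_kernel: "P' D \<in> X \<rightarrow>\<^sub>M prob_algebra X" if "is_RN_deriv \<eta> \<eta>' D" for D
    using P_kernel[OF RN_\<phi>[OF that]] by (subst measurable_cong[OF P'_eq[OF that]])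
  have P_cong: "P E q = P' D q"
    if D: "is_RN_deriv \<eta> \<eta>' D" and E: "\<And>v. v \<in> space Y \<Longrightarrow> E (q, v) = D (q, F (q, v))"
      and q: "q \<in> space X" for D E q
    unfolding P'_eq[OF D q] unfolding P_def
    using sets_eq_imp_space_eq[OF sets_V[OF q]]
    by (intro extended_kernel_cong_AE AE_I2) (simp add: acceptance_def \<phi>_def E)
  have P_ae: "AE q in \<mu>. P E q = P' D q"
    if D: "is_RN_deriv \<eta> \<eta>' D" and E: "is_RN_deriv M SM E" for D E
  proof -
    note [measurable] = borel_D[OF D] borel_E[OF E]
    \<comment> \<open>Uniqueness on \<open>M\<close> is disintegrated: outside a \<mu>-null set of
      \<open>q\<close>, the two versions agree \<open>V q\<close>-almost everywhere, which suffices
      for equal kernels at \<open>q\<close>.\<close>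
    have "AE q in \<mu>. AE v in V q. (D \<circ> \<phi>) (q, v) = E (q, v)"
      using M.is_RN_deriv_unique[OF RN_\<phi>[OF D] E]
      unfolding M_def comp_def by (intro AE_semidirect[OF \<mu> V]) measurable
    then show ?thesis
    proof (rule AE_mp, intro AE_I2 impI)
      fix q assume "q \<in> space \<mu>" and ae: "AE v in V q. (D \<circ> \<phi>) (q, v) = E (q, v)"
      then have q: "q \<in> space X"
        using sets_eq_imp_space_eq[OF \<mu>(2)] by simp
      have "AE v in V q. acceptance E (q, v) = acceptance (D \<circ> \<phi>) (q, v)"
        using ae by eventually_elim (simp add: acceptance_def)
      then show "P E q = P' D q"
        unfolding P'_eq[OF D q] unfolding P_def by (rule extended_kernel_cong_AE)
    qed
  qed

  \<comment> \<open>Matching versions, with identities at every point\<close>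
  have version_E: "\<exists>E. is_RN_deriv M SM E \<and> (\<forall>q \<in> space X. P E q = P' D q)
      \<and> (\<forall>q \<in> space X. \<forall>r \<in> space X.
           acceptance D (q, r) = acceptance E (q, section_inv Y F q r))
      \<and> (\<forall>q \<in> space X. \<forall>v \<in> space Y. acceptance E (q, v) = acceptance D (q, F (q, v)))"
    if D: "is_RN_deriv \<eta> \<eta>' D" for D
    \<comment> \<open>The witness is \<open>D \<circ> \<phi>\<close>; the pointwise identity in
      \<open>r\<close> is \<open>F (q, section_inv Y F q r) = r\<close>.\<close>
    using RN_\<phi>[OF D] P'_eq[OF D] F_section_inv[OF F_bij]
    by (intro exI[of _ "D \<circ> \<phi>"]) (simp add: acceptance_def \<phi>_def)
  have version_D: "\<exists>D. is_RN_deriv \<eta> \<eta>' D \<and> (\<forall>q \<in> space X. P E q = P' D q)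
      \<and> (\<forall>q \<in> space X. \<forall>r \<in> space X.
           acceptance D (q, r) = acceptance E (q, section_inv Y F q r))
      \<and> (\<forall>q \<in> space X. \<forall>v \<in> space Y. acceptance E (q, v) = acceptance D (q, F (q, v)))"
    if E: "is_RN_deriv M SM E" for E
    \<comment> \<open>The witness is \<open>E \<circ> \<psi>\<close>; along each fibre it agrees
      with \<open>E\<close> because \<open>section_inv Y F q\<close> cancels \<open>F (q, v)\<close>
      to \<open>v\<close>.\<close>
    using RN_\<psi>[OF E] P_cong[OF RN_\<psi>[OF E]] section_inv_F[OF F_bij]
    by (intro exI[of _ "E \<circ> \<psi>"]) (simp add: acceptance_def \<psi>_def)
  have acc_\<eta>: "AE (q, r) in \<eta>. acceptance D (q, r) = acceptance E (q, section_inv Y F q r)"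
    and acc_M: "AE (q, v) in M. acceptance E (q, v) = acceptance D (q, F (q, v))"
    if "is_RN_deriv \<eta> \<eta>' D" "is_RN_deriv M SM E" for D E
    using ae_\<eta>[OF that] ae_M[OF that] by (auto simp: acceptance_def elim!: eventually_mono)
  have inv: "S \<in> space (X \<Otimes>\<^sub>M Y) \<rightarrow> space (X \<Otimes>\<^sub>M Y)"
      "\<And>z. z \<in> space (X \<Otimes>\<^sub>M Y) \<Longrightarrow> S (S z) = z"
      "\<And>T z. T \<in> space (X \<Otimes>\<^sub>M Y) \<rightarrow> space (X \<Otimes>\<^sub>M Y) \<Longrightarrow>
        \<forall>z \<in> space (X \<Otimes>\<^sub>M Y). fst (T z) = F z \<and> T (T z) = z \<Longrightarrow>
        z \<in> space (X \<Otimes>\<^sub>M Y) \<Longrightarrow> T z = S z"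
    unfolding S_def
    using involution_space[OF F_space F_bij] involution_involution[OF F_space F_bij]
      involution_unique[OF F_space F_bij] by blast+

  show ?thesis
    apply (intro conjI impI allI ballI)
    subgoal by (rule inv(1))
    subgoal by (rule fst_S)
    subgoal by (rule inv(2))
    subgoal by (rule inv(3))
    subgoal by (rule ac)
    subgoal for D E by (rule ae_M[of D E])
    subgoal for D E by (rule ae_\<eta>[of D E])
    subgoal for D E by (rule P_kernel)
    subgoal for D E by (rule P'_kernel)
    subgoal for D E by (rule P_ae)
    subgoal for D E by (rule acc_\<eta>[of D E])
    subgoal for D E by (rule acc_M[of D E])
    subgoal by (rule version_E)
    subgoal by (rule version_D)
    done
qed

end
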